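(* Let $\lambda\supseteq\mu$ be partitions, and let $T_1,\dots,T_r$ be all the left snakes of $\lambda/\mu$ (or, alternatively, all the right snakes of $\lambda/\mu$). Then the number of interval sets of $\lambda/\mu$ is $$\mathrm{is}(\lambda/\mu)=\prod_{i=1}^r\left(1+\frac{\ell(T_i)}{2}\right).$$
   Context: Skew diagram $\lambda/\mu=\{(i,j):\mu_i<j\le\lambda_i\}$; square $(i,j)$ is drawn as $[j-1,j]\times[-i,-i+1]$. An outside top corner is $(i,j)\in\lambda/\mu$ with $(i-1,j),(i,j-1)\notin\lambda/\mu$; an inside top corner is $(i,j)\in\lambda/\mu$ with $(i-1,j),(i,j-1)\in\lambda/\mu$, $(i-1,j-1)\notin\lambda/\mu$; the diagonal of a corner $(i,j)$ is the set of $(i+p,j+p)\in\lambda/\mu$, $p\ge0$; $\mathrm{rank}(\lambda/\mu)$ is the number of squares on outside diagonals minus the number on inside diagonals. For a partition $\alpha$, its boundary path goes up $x=0$ from $y=-\infty$ to $(0,-\ell(\alpha))$, follows the lower-right boundary of the diagram of $\alpha$ to $(\alpha_1,0)$, then right along $y=0$; the unit step starting at $(x,y)$ has index $x+y$. For $k\in\mathbb{Z}$ let $e_k$ be step $k$ of the boundary path of $\lambda$. If $e_k$ is also a step of the boundary path of $\mu$, $S_k=\emptyset$. Otherwise, if $e_k$ is horizontal it is the lower edge of a square $(i,j)\in\lambda/\mu$ and $S_k=(\lambda/\mu)\cap\{(i,j),(i,j-1),(i-1,j-1),(i-1,j-2),\dots\}$; if vertical it is the right edge of $(i,j)\in\lambda/\mu$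 and $S_k=(\lambda/\mu)\cap\{(i,j),(i-1,j),(i-1,j-1),(i-2,j-1),\dots\}$. Length $\ell(S_k)=|S_k|-1$. $S_k$ is a left snake if $e_k$ is horizontal and $\ell(S_k)$ is even ($\ge0$), a right snake if $e_k$ is vertical and $\ell(S_k)$ is even. Snake sequence: $q_k=L_m$ if $S_k$ is a left snake of length $2m$, $R_m$ if a right snake of length $2m$, $O$ otherwise. With $r=\mathrm{rank}(\lambda/\mu)$, an interval set of $\lambda/\mu$ is a set $\{(u_1,v_1),\dots,(u_r,v_r)\}$ of pairs of integers, the $2r$ integers $u_i,v_i$ being distinct, with $u_i<v_i$, each $q_{u_i}$ equal to some $L_s$ and each $q_{v_i}$ equal to some $R_t$. $\mathrm{is}(\lambda/\mu)$ is the number of interval sets. *)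

theory Defs
  imports Complex_Main
begin

text \<open>Partitions are weakly decreasing lists of positive integers; rows and columns of squares are
  integers, so that \<open>(i - 1, j - 1)\<close> makes sense for every square.\<close>

definition is_partition :: "nat list \<Rightarrow> bool" where
  "is_partition al \<longleftrightarrow> sorted_wrt (\<ge>) al \<and> 0 \<notin> set al"

text \<open>Parts are numbered from 1; \<open>part al i\<close> is 0 for all \<open>i\<close> outside \<open>1..length al\<close>.\<close>

definition part :: "nat list \<Rightarrow> int \<Rightarrow> int" where
  "part al i = (if 1 \<le> i \<and> i \<le> int (length al) then int (al ! nat (i - 1)) else 0)"

definition part_le :: "nat list \<Rightarrow> nat list \<Rightarrow> bool" where
  "part_le mu lam \<longleftrightarrow> (\<forall>i\<ge>1. part mu i \<le> part lam i)"

type_synonym square = "int \<times> int"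

definition skew :: "nat list \<Rightarrow> nat list \<Rightarrow> square set" where
  "skew lam mu = {(i, j). 1 \<le> i \<and> part mu i < j \<and> j \<le> part lam i}"

definition outside_top_corner :: "nat list \<Rightarrow> nat list \<Rightarrow> square \<Rightarrow> bool" where
  "outside_top_corner lam mu = (\<lambda>(i, j). (i, j) \<in> skew lam mu \<and>
     (i - 1, j) \<notin> skew lam mu \<and> (i, j - 1) \<notin> skew lam mu)"

definition inside_top_corner :: "nat list \<Rightarrow> nat list \<Rightarrow> square \<Rightarrow> bool" where
  "inside_top_corner lam mu = (\<lambda>(i, j). (i, j) \<in> skew lam mu \<and>
     (i - 1, j) \<in> skew lam mu \<and> (i, j - 1) \<in> skew lam mu \<and> (i - 1, j - 1) \<notin> skew lam mu)"

definition diagonal :: "nat list \<Rightarrow> nat list \<Rightarrow> square \<Rightarrow> square set" where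
  "diagonal lam mu = (\<lambda>(i, j). skew lam mu \<inter> {(i + p, j + p) | p. p \<ge> 0})"

definition skew_rank :: "nat list \<Rightarrow> nat list \<Rightarrow> int" where
  "skew_rank lam mu =
     int (card (\<Union>c \<in> {c. outside_top_corner lam mu c}. diagonal lam mu c)) -
     int (card (\<Union>c \<in> {c. inside_top_corner lam mu c}. diagonal lam mu c))"

text \<open>Unit steps of lattice paths, given by their starting point: \<open>HStep x y\<close> runs from \<open>(x, y)\<close> to
  \<open>(x + 1, y)\<close> and \<open>VStep x y\<close> from \<open>(x, y)\<close> to \<open>(x, y + 1)\<close>. In this picture the square \<open>(i, j)\<close> is
  \<open>[j - 1, j] \<times> [-i, -i + 1]\<close>.\<close>

datatype step = HStep int int | VStep int int

fun horizontal :: "step \<Rightarrow> bool" where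
  "horizontal (HStep x y) = True"
| "horizontal (VStep x y) = False"

fun step_index :: "step \<Rightarrow> int" where
  "step_index (HStep x y) = x + y"
| "step_index (VStep x y) = x + y"

text \<open>The four pieces: the negative \<open>y\<close>-axis below \<open>(0, -length al)\<close>; the right ends of the rows of
  the diagram; the part of the lower side of each row that is not above the next row; the
  positive \<open>x\<close>-axis from \<open>(part al 1, 0)\<close>.\<close>

definition boundary_path :: "nat list \<Rightarrow> step set" where
  "boundary_path al =
     {VStep 0 y | y. y < - int (length al)} \<union>
     {VStep (part al i) (- i) | i. 1 \<le> i \<and> i \<le> int (length al)} \<union>
     {HStep x (- i) | x i. 1 \<le> i \<and> i \<le> int (length al) \<and> part al (i + 1) \<le> x \<and> x < part al i} \<union>
     {HStep x 0 | x. part al 1 \<le> x}"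

text \<open>The boundary path of a partition has exactly one step of each index (\<open>boundary_path_ex1\<close>),
  so that \<open>boundary_step\<close> is well defined.\<close>

lemma part_antimono:
  assumes "is_partition al" "1 \<le> i" "i \<le> i'"
  shows "part al i' \<le> part al i"
proof (cases "i < i' \<and> i' \<le> int (length al)")
  case True
  then have "nat (i - 1) < nat (i' - 1)" "nat (i' - 1) < length al"
    using assms by linarith+
  then have "al ! nat (i' - 1) \<le> al ! nat (i - 1)"
    using assms(1) by (simp add: is_partition_def sorted_wrt_iff_nth_less)
  then show ?thesis using True assms by (simp add: part_def)
next
  case False
  then show ?thesis using assms by (auto simp: part_def)
qed

lemma boundary_path_altdef:
  assumes "is_partition al"
  shows "e \<in> boundary_path al \<and> step_index e = k \<longleftrightarrow>
    (\<exists>n\<ge>1. part al n - n \<le> k \<and> (n = 1 \<or> k < part al (n - 1) - (n - 1)) \<and>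
       e = (if part al n - n = k then VStep (part al n) (- n) else HStep (k + (n - 1)) (1 - n)))"
    (is "?L \<longleftrightarrow> (\<exists>n\<ge>1. ?P n)")
proof
  assume L: ?L
  then consider (a) y where "e = VStep 0 y" "y < - int (length al)" "y = k"
    | (b) i where "e = VStep (part al i) (- i)" "1 \<le> i" "i \<le> int (length al)" "part al i - i = k"
    | (c) x i where "e = HStep x (- i)" "1 \<le> i" "i \<le> int (length al)"
        "part al (i + 1) \<le> x" "x < part al i" "x - i = k"
    | (d) "e = HStep k 0" "part al 1 \<le> k"
    unfolding boundary_path_def by fastforce
  then show "\<exists>n\<ge>1. ?P n"
  proof cases
    case a
    have "part al (- y) = 0" using a by (simp add: part_def)
    moreover have "part al (- y - 1) \<ge> 0" by (simp add: part_def)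
    ultimately show ?thesis using a by (intro exI[of _ "- y"]) auto
  next
    case b
    have "part al i \<le> part al (i - 1) \<or> i = 1"
    proof (rule disjCI)
      assume that: "i \<noteq> 1"
      show "part al i \<le> part al (i - 1)"
        by (rule part_antimono[OF assms]) (use b that in linarith)+
    qed
    then show ?thesis using b by (intro exI[of _ i]) auto
  next
    case c
    then show ?thesis by (intro exI[of _ "i + 1"]) auto
  next
    case d
    then show ?thesis by (intro exI[of _ 1]) auto
  qed
next
  assume "\<exists>n\<ge>1. ?P n"
  then obtain n where n: "n \<ge> 1" "?P n" by blast
  have z: "part al n = 0" if "n > int (length al)" using that by (simp add: part_def)
  show ?L
  proof (cases "part al n - n = k")
    case True
    then show ?thesis using n z
      by (cases "n \<le> int (length al)") (auto simp: boundary_path_def)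
  next
    case F: False
    show ?thesis
    proof (cases "n = 1")
      case True
      then show ?thesis using n F by (auto simp: boundary_path_def)
    next
      case False
      have "n - 1 \<le> int (length al)"
      proof (rule ccontr)
        assume "\<not> ?thesis"
        then have "part al n = 0" "part al (n - 1) = 0" by (simp_all add: part_def)
        then show False using n F False by auto
      qed
      then have "\<exists>x i. e = HStep x (- i) \<and> 1 \<le> i \<and> i \<le> int (length al) \<and>
          part al (i + 1) \<le> x \<and> x < part al i"
        using n F False by (intro exI[of _ "k + (n - 1)"] exI[of _ "n - 1"]) auto
      then show ?thesis using n F by (auto simp: boundary_path_def)
    qed
  qed
qed

lemma boundary_path_ex1:
  assumes "is_partition al"
  shows "\<exists>!e. e \<in> boundary_path al \<and> step_index e = k"
proof -
  define Q where "Q n \<longleftrightarrow> n \<ge> 1 \<and> part al n - n \<le> k \<and> (n = 1 \<or> k < part al (n - 1) - (n - 1))"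
    for n
  define N where "N = (LEAST m. part al (int m + 1) - (int m + 1) \<le> k)"
  have ex: "part al (int (length al + nat \<bar>k\<bar>) + 1) - (int (length al + nat \<bar>k\<bar>) + 1) \<le> k"
    unfolding part_def by (simp; linarith)
  have N1: "part al (int N + 1) - (int N + 1) \<le> k"
    unfolding N_def by (rule LeastI[of _ "length al + nat \<bar>k\<bar>"], rule ex)
  have N2: "k < part al (int N) - int N" if "N \<noteq> 0"
  proof -
    have "\<not> part al (int (N - 1) + 1) - (int (N - 1) + 1) \<le> k"
      using that unfolding N_def by (intro not_less_Least) simp
    then show ?thesis using that by (simp add: of_nat_diff)
  qed
  have Q: "Q (int N + 1)" using N1 N2 by (auto simp: Q_def)
  have uniq: "n \<ge> m" if "Q n" "Q m" for n m
  proof (rule ccontr)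
    assume nm: "\<not> n \<ge> m"
    then have "part al (m - 1) \<le> part al n"
      using part_antimono[OF assms, of n "m - 1"] that by (auto simp: Q_def)
    then show False using that nm by (auto simp: Q_def)
  qed
  have *: "n = int N + 1" if "Q n" for n
    using uniq[OF that Q] uniq[OF Q that] by simp
  let ?n = "int N + 1"
  let ?e = "if part al ?n - ?n = k then VStep (part al ?n) (- ?n) else HStep (k + (?n - 1)) (1 - ?n)"
  show ?thesis
  proof (rule ex1I[of _ ?e])
    show "?e \<in> boundary_path al \<and> step_index ?e = k"
      unfolding boundary_path_altdef[OF assms] using Q unfolding Q_def by blast
  next
    fix e
    assume "e \<in> boundary_path al \<and> step_index e = k"
    then obtain n where "Q n" and
      e: "e = (if part al n - n = k then VStep (part al n) (- n) else HStep (k + (n - 1)) (1 - n))"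
      unfolding boundary_path_altdef[OF assms] Q_def by blast
    then show "e = ?e" using *[OF \<open>Q n\<close>] by (simp only:)
  qed
qed

definition boundary_step :: "nat list \<Rightarrow> int \<Rightarrow> step" where
  "boundary_step al k = (THE e. e \<in> boundary_path al \<and> step_index e = k)"

text \<open>\<open>HStep x y\<close> is the lower edge of the square \<open>(-y, x + 1)\<close>, and \<open>VStep x y\<close> is the right edge of
  the square \<open>(-y, x)\<close>. The two sets in each union are the alternate squares of the staircase going
  up and to the left from that square.\<close>

fun staircase :: "step \<Rightarrow> square set" where
  "staircase (HStep x y) = (let i = - y; j = x + 1 in
     {(i - p, j - p) | p. p \<ge> 0} \<union> {(i - p, j - 1 - p) | p. p \<ge> 0})"
| "staircase (VStep x y) = (let i = - y; j = x in
     {(i - p, j - p) | p. p \<ge> 0} \<union> {(i - 1 - p, j - p) | p. p \<ge> 0})"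

definition snake :: "nat list \<Rightarrow> nat list \<Rightarrow> int \<Rightarrow> square set" where
  "snake lam mu k = (let e = boundary_step lam k in
     if e \<in> boundary_path mu then {} else skew lam mu \<inter> staircase e)"

text \<open>The empty set has length \<open>-1\<close>, hence it is neither a left nor a right snake.\<close>

definition snake_length :: "square set \<Rightarrow> int" where
  "snake_length S = int (card S) - 1"

definition left_snake :: "nat list \<Rightarrow> nat list \<Rightarrow> int \<Rightarrow> bool" where
  "left_snake lam mu k \<longleftrightarrow> horizontal (boundary_step lam k) \<and>
     snake_length (snake lam mu k) \<ge> 0 \<and> even (snake_length (snake lam mu k))"

definition right_snake :: "nat list \<Rightarrow> nat list \<Rightarrow> int \<Rightarrow> bool" where
  "right_snake lam mu k \<longleftrightarrow> \<not> horizontal (boundary_step lam k) \<and>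
     snake_length (snake lam mu k) \<ge> 0 \<and> even (snake_length (snake lam mu k))"

datatype snake_symbol = SymL nat | SymR nat | SymO

definition snake_sequence :: "nat list \<Rightarrow> nat list \<Rightarrow> int \<Rightarrow> snake_symbol" where
  "snake_sequence lam mu k =
     (if left_snake lam mu k then SymL (nat (snake_length (snake lam mu k) div 2))
      else if right_snake lam mu k then SymR (nat (snake_length (snake lam mu k) div 2))
      else SymO)"

definition interval_set :: "nat list \<Rightarrow> nat list \<Rightarrow> (int \<times> int) set \<Rightarrow> bool" where
  "interval_set lam mu I \<longleftrightarrow>
     finite I \<and> int (card I) = skew_rank lam mu \<and>
     card (fst ` I \<union> snd ` I) = 2 * card I \<and>
     (\<forall>(u, v) \<in> I. u < v \<and> (\<exists>s. snake_sequence lam mu u = SymL s) \<and>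
                            (\<exists>t. snake_sequence lam mu v = SymR t))"

definition num_interval_sets :: "nat list \<Rightarrow> nat list \<Rightarrow> nat" where
  "num_interval_sets lam mu = card {I. interval_set lam mu I}"

end

theory Submission
  imports Defs
begin

text \<open>The boundary paths of \<open>lam\<close> and \<open>mu\<close> meet the line \<open>x + y = k\<close> in one point each; let \<open>d k\<close> be the
  number of squares of the skew diagram on that line between the two points. The \<open>k\<close>-th snake is the
  union of the lines \<open>k\<close> and \<open>k + 1\<close>, so it has \<open>d k + d (k + 1)\<close> squares, and it is a left snake
  iff \<open>d\<close> goes up by one from \<open>k\<close> to \<open>k + 1\<close> and a right snake iff it goes down by one. Summation by
  parts identifies the rank with the number of up-steps, so interval sets are the perfect matchings
  that match each up-step with a later down-step. Choosing partners for the up-steps from right to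
  left leaves exactly \<open>d k + 1 = 1 + length / 2\<close> choices for the up-step \<open>k\<close>; choosing partners for
  the down-steps from left to right gives the second product.\<close>

section \<open>Matchings into nested neighbourhoods\<close>

text \<open>Graphs of systems of distinct representatives for the family \<open>N\<close> on
  \<open>A\<close>, kept as sets of pairs because interval sets have that form.\<close>

definition matchings :: "'a set \<Rightarrow> ('a \<Rightarrow> 'b set) \<Rightarrow> ('a \<times> 'b) set set" where
  "matchings A N = {I. I \<subseteq> Sigma A N \<and> fst ` I = A \<and> inj_on fst I \<and> inj_on snd I}"

lemma matchings_empty: "matchings {} N = {{}}"
  by (auto simp: matchings_def)

lemma finite_matchings:
  assumes "finite A" "\<And>a. a \<in> A \<Longrightarrow> finite (N a)"
  shows "finite (matchings A N)"
  by (rule finite_subset[of _ "Pow (Sigma A N)"]) (use assms in \<open>auto simp: matchings_def\<close>)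

text \<open>Deleting the pair at \<open>a\<close> inverts the map: the rest matches
  \<open>A\<close>, and the partner of \<open>a\<close> can be any element of \<open>N a\<close>
  still free.\<close>

lemma matchings_insert:
  assumes "a \<notin> A"
  shows "bij_betw (\<lambda>(I, v). insert (a, v) I)
    (SIGMA I:matchings A N. N a - snd ` I) (matchings (insert a A) N)"
proof (rule bij_betw_byWitness[where f' = "\<lambda>J. (J - {a} \<times> UNIV, THE v. (a, v) \<in> J)"])
  have fresh: "(a, w) \<notin> I" if "I \<in> matchings A N" for I w
    using that assms by (auto simp: matchings_def)
  show "\<forall>p\<in>SIGMA I:matchings A N. N a - snd ` I.
    (\<lambda>J. (J - {a} \<times> UNIV, THE v. (a, v) \<in> J)) ((\<lambda>(I, v). insert (a, v) I) p) = p"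
    using fresh by auto
  have uniq: "(THE v. (a, v) \<in> J) = v" if "J \<in> matchings (insert a A) N" "(a, v) \<in> J" for J v
  proof (rule the_equality)
    fix w assume "(a, w) \<in> J"
    then show "w = v"
      using that inj_onD[of fst J "(a, w)" "(a, v)"] by (simp add: matchings_def)
  qed (use that in simp)
  have ex: "\<exists>v. (a, v) \<in> J" if "J \<in> matchings (insert a A) N" for J
  proof -
    have "a \<in> fst ` J" using that by (simp add: matchings_def)
    then show ?thesis by force
  qed
  have single: "J = insert (a, v) (J - {a} \<times> UNIV)"
    if "J \<in> matchings (insert a A) N" "(a, v) \<in> J" for J v
    using that uniq[OF that(1)] by auto
  show "\<forall>J\<in>matchings (insert a A) N.
    (\<lambda>(I, v). insert (a, v) I) ((\<lambda>J. (J - {a} \<times> UNIV, THE v. (a, v) \<in> J)) J) = J"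
    using ex uniq single by (metis case_prod_conv)
  show "(\<lambda>(I, v). insert (a, v) I) ` (SIGMA I:matchings A N. N a - snd ` I)
      \<subseteq> matchings (insert a A) N"
    using assms by (force simp: matchings_def)
  show "(\<lambda>J. (J - {a} \<times> UNIV, THE v. (a, v) \<in> J)) ` matchings (insert a A) N
      \<subseteq> (SIGMA I:matchings A N. N a - snd ` I)"
  proof clarify
    fix J assume J: "J \<in> matchings (insert a A) N"
    then obtain v where v: "(a, v) \<in> J" using ex by blast
    let ?I = "J - {a} \<times> UNIV"
    have "fst ` ?I = fst ` J - {a}" by force
    then have "fst ` ?I = A" using J assms by (simp add: matchings_def)
    then have "?I \<in> matchings A N"
      using J by (auto simp: matchings_def intro: inj_on_subset)
    moreover have "v \<notin> snd ` ?I"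
    proof
      assume "v \<in> snd ` ?I"
      then obtain p where p: "p \<in> ?I" "v = snd p" by (rule imageE)
      then have "p = (a, v)"
        using J v inj_onD[of snd J p "(a, v)"] by (simp add: matchings_def)
      with p(1) show False by simp
    qed
    then have "v \<in> N a - snd ` ?I"
      using J v by (auto simp: matchings_def)
    ultimately show "?I \<in> matchings A N \<and> (THE v. (a, v) \<in> J) \<in> N a - snd ` ?I"
      using uniq[OF J v] by simp
  qed
qed

text \<open>Partners are chosen in order of increasing \<open>f\<close>: since all earlier partners lie in \<open>N a\<close>, the
  element \<open>a\<close> has exactly as many choices left as the factor says. Truncated subtraction is harmless:
  if it occurs, there is no matching and some factor is 0.\<close>

lemma card_matchings:
  fixes f :: "'a \<Rightarrow> 'c::linorder"
  assumes "finite A" "inj_on f A"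
    and "\<And>a. a \<in> A \<Longrightarrow> finite (N a)"
    and "\<And>a b. a \<in> A \<Longrightarrow> b \<in> A \<Longrightarrow> f a \<le> f b \<Longrightarrow> N a \<subseteq> N b"
  shows "card (matchings A N) = (\<Prod>a\<in>A. card (N a) - card {b \<in> A. f b < f a})"
  using assms
proof (induction A rule: finite_ranking_induct[where f = f])
  case empty
  then show ?case by (simp add: matchings_empty)
next
  case (insert a A)
  show ?case
  proof (cases "a \<in> A")
    case True
    then show ?thesis using insert.IH insert.prems by (simp add: insert_absorb)
  next
    case False
    \<comment> \<open>The ranking induction gives only \<open>f b \<le> f a\<close>; injectivity
      makes it strict.\<close>
    have less: "f b < f a" if "b \<in> A" for b
      using that insert False by (metis inj_on_eq_iff insertCI order_le_less)
    have extensions: "card (N a - snd ` I) = card (N a) - card A" if "I \<in> matchings A N" for I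
    proof -
      have "snd ` I \<subseteq> N a"
        using that insert.prems(3)[of _ a] less by (fastforce simp: matchings_def)
      moreover have "card (snd ` I) = card A"
        using that by (auto simp: matchings_def card_image)
      ultimately show ?thesis
        using insert.prems(2)[of a] by (simp add: card_Diff_subset finite_subset)
    qed
    have *: "{b. (b = a \<or> b \<in> A) \<and> f b < f c} = {b \<in> A. f b < f c}" if "c \<in> insert a A" for c
      using that less by (auto dest: less_asym)
    have "card (matchings (insert a A) N) = card (SIGMA I:matchings A N. N a - snd ` I)"
      using bij_betw_same_card[OF matchings_insert] False by metis
    also have "\<dots> = (\<Sum>I\<in>matchings A N. card (N a - snd ` I))"
      using insert by (intro card_SigmaI finite_matchings) auto
    also have "\<dots> = card (matchings A N) * (card (N a) - card A)"
      using extensions by simp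
    also have "card (matchings A N) = (\<Prod>c\<in>A. card (N c) - card {b \<in> A. f b < f c})"
      using insert by (intro insert.IH) auto
    also have "card A = card {b \<in> A. f b < f a}"
      using less by (intro arg_cong[where f = card]) auto
    finally show ?thesis
      using insert.hyps False * by (simp add: mult.commute)
  qed
qed

text \<open>Since \<open>matchings\<close> treats the two components differently, passing to
  converses lets the down-steps become the index set.\<close>

lemma converse_projections:
  fixes I :: "('a \<times> 'b) set"
  shows "fst ` I\<inverse> = snd ` I" "inj_on fst (I\<inverse>) = inj_on snd I" "inj_on snd (I\<inverse>) = inj_on fst I"
proof -
  have swap: "I\<inverse> = prod.swap ` I"
    by (simp add: set_eq_iff image_iff Bex_def split_paired_Ex)
  have proj: "fst \<circ> prod.swap = (snd :: 'a \<times> 'b \<Rightarrow> 'b)" "snd \<circ> prod.swap = (fst :: 'a \<times> 'b \<Rightarrow> 'a)"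
    by (simp_all add: fun_eq_iff)
  show "fst ` I\<inverse> = snd ` I" by (simp only: swap image_comp proj)
  show "inj_on fst (I\<inverse>) = inj_on snd I" "inj_on snd (I\<inverse>) = inj_on fst I"
    using comp_inj_on_iff[of prod.swap I fst] comp_inj_on_iff[of prod.swap I snd]
    by (simp_all only: swap proj inj_on_subset[OF inj_swap subset_UNIV])
qed

section \<open>Up-steps and down-steps of an integer path\<close>

lemma sum_int_telescope:
  fixes f :: "int \<Rightarrow> 'a::ab_group_add"
  assumes "a \<le> b"
  shows "(\<Sum>k\<in>{a..<b}. f (k + 1) - f k) = f b - f a"
  using assms
proof (induction b rule: int_ge_induct)
  case (step b)
  then have "{a..<b + 1} = insert b {a..<b}" by auto
  with step show ?case by simp
qed simp

text \<open>Isolates the properties of the height difference of two boundary paths on which the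
  counting rests.\<close>

locale bump_path =
  fixes d :: "int \<Rightarrow> int" and K :: int
  assumes nonneg: "d k \<ge> 0"
    and small_steps: "\<bar>d (k + 1) - d k\<bar> \<le> 1"
    and support: "k \<le> - K \<or> K \<le> k \<Longrightarrow> d k = 0"
begin

definition ups :: "int set" where "ups = {k. d (k + 1) = d k + 1}"
definition downs :: "int set" where "downs = {k. d (k + 1) = d k - 1}"

lemma steps_bounded: "ups \<subseteq> {- K..<K}" "downs \<subseteq> {- K..<K}"
proof -
  \<comment> \<open>The window contains \<open>- K\<close>, since the step from \<open>- K\<close>
    to \<open>- K + 1\<close> can already leave height 0.\<close>
  have "k \<in> {- K..<K}" if "d (k + 1) \<noteq> d k" for k
    using that support[of k] support[of "k + 1"] by fastforce
  then show "ups \<subseteq> {- K..<K}" "downs \<subseteq> {- K..<K}"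
    by (auto simp: ups_def downs_def)
qed

lemma finite_steps: "finite ups" "finite downs"
  using steps_bounded finite_subset by blast+

lemma disjoint_steps: "ups \<inter> downs = {}"
  by (auto simp: ups_def downs_def)

lemma increment: "d (k + 1) - d k = of_bool (k \<in> ups) - of_bool (k \<in> downs)"
  using small_steps[of k] by (auto simp: ups_def downs_def)

lemma height_difference:
  assumes "a \<le> b"
  shows "d b - d a = int (card (ups \<inter> {a..<b})) - int (card (downs \<inter> {a..<b}))"
proof -
  have "int (card (X \<inter> {a..<b})) = (\<Sum>k\<in>{a..<b}. of_bool (k \<in> X))" for X
    by (simp add: Int_commute)
  then show ?thesis
    using sum_int_telescope[OF assms, of d] by (simp add: increment sum_subtractf)
qed

lemma card_steps_before: "int (card {u \<in> ups. u < k}) = d k + int (card {v \<in> downs. v < k})"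
proof -
  \<comment> \<open>Chosen at or left of \<open>- K\<close>, so that \<open>d a = 0\<close> and no
    step precedes \<open>a\<close>.\<close>
  define a where "a = min k (- K)"
  have "{u \<in> ups. u < k} = ups \<inter> {a..<k}" "{v \<in> downs. v < k} = downs \<inter> {a..<k}"
    using steps_bounded by (auto simp: a_def)
  then show ?thesis
    using height_difference[of a k] support[of a] by (simp add: a_def)
qed

lemma card_steps_after: "int (card {v \<in> downs. k < v}) = d (k + 1) + int (card {u \<in> ups. k < u})"
proof -
  define b where "b = max (k + 1) K"
  have "{u \<in> ups. k < u} = ups \<inter> {k + 1..<b}" "{v \<in> downs. k < v} = downs \<inter> {k + 1..<b}"
    using steps_bounded by (auto simp: b_def)
  then show ?thesis
    using height_difference[of "k + 1" b] support[of b] by (simp add: b_def)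
qed

lemma card_ups_eq_card_downs: "card ups = card downs"
proof -
  have "{u \<in> ups. u < K} = ups" "{v \<in> downs. v < K} = downs"
    using steps_bounded by auto
  then show ?thesis using card_steps_before[of K] support[of K] by simp
qed

definition step_matchings :: "(int \<times> int) set set" where
  "step_matchings = {I. finite I \<and> card I = card ups \<and> card (fst ` I \<union> snd ` I) = 2 * card I \<and>
    (\<forall>(u, v)\<in>I. u < v \<and> u \<in> ups \<and> v \<in> downs)}"

text \<open>Each projection has at most \<open>card I\<close> values, so a union of size
  \<open>2 * card I\<close> forces both to be injective; equal cardinalities then make them onto
  \<open>ups\<close> and \<open>downs\<close>.\<close>

lemma step_matchingsD:
  assumes "I \<in> step_matchings"
  shows "I \<subseteq> (SIGMA u:ups. {v \<in> downs. u < v})" "inj_on fst I" "inj_on snd I"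
    "fst ` I = ups" "snd ` I = downs"
proof -
  have fin: "finite I" and c: "card I = card ups" "card (fst ` I \<union> snd ` I) = 2 * card I"
    using assms by (auto simp: step_matchings_def)
  show sub: "I \<subseteq> (SIGMA u:ups. {v \<in> downs. u < v})"
    using assms by (auto simp: step_matchings_def)
  have "card (fst ` I \<union> snd ` I) \<le> card (fst ` I) + card (snd ` I)"
    by (rule card_Un_le)
  then have cards: "card (fst ` I) = card I" "card (snd ` I) = card I"
    using card_image_le[OF fin, of fst] card_image_le[OF fin, of snd] c by linarith+
  then show "inj_on fst I" "inj_on snd I"
    using fin by (auto intro: eq_card_imp_inj_on)
  show "fst ` I = ups" "snd ` I = downs"
  proof -
    have "fst ` I \<subseteq> ups" "snd ` I \<subseteq> downs" using sub by auto
    then show "fst ` I = ups" "snd ` I = downs"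
      using cards c card_ups_eq_card_downs finite_steps by (simp_all add: card_subset_eq)
  qed
qed

text \<open>Covering one side fixes \<open>card I\<close>, because there are as many up-steps as
  down-steps; this serves the view from either side.\<close>

lemma step_matchingsI:
  assumes "I \<subseteq> (SIGMA u:ups. {v \<in> downs. u < v})" "inj_on fst I" "inj_on snd I"
    and "fst ` I = ups \<or> snd ` I = downs"
  shows "I \<in> step_matchings"
proof -
  have "finite I"
    using assms(1) finite_steps by (auto intro: finite_subset[of _ "ups \<times> downs"])
  moreover have c: "card I = card ups"
    using assms card_image card_ups_eq_card_downs by metis
  moreover have "fst ` I \<inter> snd ` I = {}"
    using assms(1) disjoint_steps by (auto; blast)
  then have "card (fst ` I \<union> snd ` I) = card (fst ` I) + card (snd ` I)"
    using \<open>finite I\<close> by (simp add: card_Un_disjoint)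
  ultimately show ?thesis
    using assms by (auto simp: step_matchings_def card_image)
qed

lemma step_matchings_eq: "step_matchings = matchings ups (\<lambda>u. {v \<in> downs. u < v})"
proof (rule set_eqI)
  fix I
  show "I \<in> step_matchings \<longleftrightarrow> I \<in> matchings ups (\<lambda>u. {v \<in> downs. u < v})"
    unfolding matchings_def mem_Collect_eq
    by (intro iffI conjI step_matchingsI disjI1; (elim conjE)?; (assumption | erule step_matchingsD))
qed

lemma converse_step_matchings: "converse ` step_matchings = matchings downs (\<lambda>v. {u \<in> ups. u < v})"
proof -
  have *: "I\<inverse> \<in> matchings downs (\<lambda>v. {u \<in> ups. u < v}) \<longleftrightarrow> I \<in> step_matchings" for I
  proof -
    have "I\<inverse> \<subseteq> (SIGMA v:downs. {u \<in> ups. u < v}) \<longleftrightarrow> I \<subseteq> (SIGMA u:ups. {v \<in> downs. u < v})"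
      unfolding subset_iff split_paired_All by simp blast
    then show ?thesis
      unfolding matchings_def converse_projections mem_Collect_eq
      by (simp only:)
        (intro iffI conjI step_matchingsI disjI2; (elim conjE)?; (assumption | erule step_matchingsD))
  qed
  show ?thesis
  proof (intro equalityI subsetI)
    fix J assume "J \<in> matchings downs (\<lambda>v. {u \<in> ups. u < v})"
    then have "J\<inverse> \<in> step_matchings" using *[of "J\<inverse>"] by (simp only: converse_converse)
    then have "(J\<inverse>)\<inverse> \<in> converse ` step_matchings" by (rule imageI)
    then show "J \<in> converse ` step_matchings" by (simp only: converse_converse)
  next
    fix J assume "J \<in> converse ` step_matchings"
    then show "J \<in> matchings downs (\<lambda>v. {u \<in> ups. u < v})" using * by (elim imageE) (simp only:)
  qed
qed

section \<open>Counting the matchings from either side\<close>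

lemma card_step_matchings_ups: "int (card step_matchings) = (\<Prod>u\<in>ups. d u + 1)"
proof -
  \<comment> \<open>Negation reverses the order: the set of later down-steps shrinks as
    \<open>u\<close> moves right, so the rightmost up-step chooses first.\<close>
  have "card step_matchings = (\<Prod>u\<in>ups. card {v \<in> downs. u < v} - card {w \<in> ups. - w < - u})"
    unfolding step_matchings_eq using finite_steps by (intro card_matchings) auto
  also have "int \<dots> = (\<Prod>u\<in>ups. d u + 1)"
  proof (unfold of_nat_prod, intro prod.cong refl)
    fix u assume "u \<in> ups"
    \<comment> \<open>The free later down-steps number \<open>d (u + 1)\<close>, the height after
      the step.\<close>
    then have "d (u + 1) = d u + 1" by (simp add: ups_def)
    then show "int (card {v \<in> downs. u < v} - card {w \<in> ups. - w < - u}) = d u + 1"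
      using card_steps_after[of u] nonneg[of u] by simp
  qed
  finally show ?thesis .
qed

lemma card_step_matchings_downs: "int (card step_matchings) = (\<Prod>v\<in>downs. d v)"
proof -
  have "card step_matchings = card (converse ` step_matchings)"
    by (intro card_image[symmetric] inj_onI) simp
  also have "\<dots> = (\<Prod>v\<in>downs. card {u \<in> ups. u < v} - card {w \<in> downs. w < v})"
    unfolding converse_step_matchings
    using finite_steps by (intro card_matchings[where f = "\<lambda>v. v"]) auto
  also have "int \<dots> = (\<Prod>v\<in>downs. d v)"
  proof (unfold of_nat_prod, intro prod.cong refl)
    fix v
    show "int (card {u \<in> ups. u < v} - card {w \<in> downs. w < v}) = d v"
      using card_steps_before[of v] nonneg[of v] by linarith
  qed
  finally show ?thesis .
qed

end

section \<open>Boundary paths\<close>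

text \<open>\<open>depth al k\<close> is the number of rows \<open>i\<close> with \<open>part al i - i \<ge> k\<close>, so that the boundary path
  meets the line \<open>x + y = k\<close> in the point \<open>(k + depth al k, - depth al k)\<close>.\<close>

definition depth :: "nat list \<Rightarrow> int \<Rightarrow> int" where
  "depth al k = int (LEAST m. part al (int m + 1) - (int m + 1) < k)"

lemma part_nonneg: "part al i \<ge> 0"
  by (simp add: part_def)

lemma depth_nonneg: "depth al k \<ge> 0"
  by (simp add: depth_def)

text \<open>As \<open>part al i - i\<close> strictly decreases in \<open>i\<close>, the rows
  reaching \<open>k\<close> form an initial segment, ending just before the first row that
  fails.\<close>

lemma le_depth_iff:
  assumes "is_partition al" "1 \<le> i"
  shows "i \<le> depth al k \<longleftrightarrow> k \<le> part al i - i"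
proof -
  define P where "P m \<longleftrightarrow> part al (int m + 1) - (int m + 1) < k" for m :: nat
  have depth: "depth al k = int (Least P)"
    unfolding depth_def P_def ..
  have "P (length al + nat \<bar>k\<bar>)"
    unfolding P_def part_def by (simp; linarith)
  then have least: "P (Least P)" by (rule LeastI)
  show ?thesis
  proof
    assume "i \<le> depth al k"
    then have "nat (i - 1) < Least P" using assms depth by linarith
    then have "\<not> P (nat (i - 1))" by (rule not_less_Least)
    then show "k \<le> part al i - i" using assms by (simp add: P_def)
  next
    assume k: "k \<le> part al i - i"
    show "i \<le> depth al k"
    proof (rule ccontr)
      assume "\<not> i \<le> depth al k"
      then have "part al i \<le> part al (depth al k + 1)"
        using depth_nonneg[of al k] by (intro part_antimono[OF assms(1)]) auto
      then show False using least k \<open>\<not> i \<le> depth al k\<close> by (simp add: P_def depth)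
    qed
  qed
qed

text \<open>At most one row has \<open>part al i - i = k\<close>, so raising the threshold by one
  loses at most one row.\<close>

lemma depth_step:
  assumes "is_partition al"
  shows "depth al (k + 1) \<le> depth al k" "depth al k \<le> depth al (k + 1) + 1"
proof -
  show "depth al (k + 1) \<le> depth al k"
    using le_depth_iff[OF assms, of "depth al (k + 1)" k]
      le_depth_iff[OF assms, of "depth al (k + 1)" "k + 1"] depth_nonneg[of al k]
    by (cases "depth al (k + 1) \<ge> 1") auto
  show "depth al k \<le> depth al (k + 1) + 1"
  proof (cases "depth al k \<ge> 2")
    case True
    then have "k \<le> part al (depth al k) - depth al k"
      using le_depth_iff[OF assms, of "depth al k" k] by simp
    moreover have "part al (depth al k) \<le> part al (depth al k - 1)"
      using True by (intro part_antimono[OF assms]) auto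
    ultimately show ?thesis
      using True le_depth_iff[OF assms, of "depth al k - 1" "k + 1"] by simp
  qed (use depth_nonneg[of al "k + 1"] in simp)
qed

lemma depth_eq_0:
  assumes "is_partition al" "part al 1 \<le> k"
  shows "depth al k = 0"
  using le_depth_iff[OF assms(1), of 1 k] depth_nonneg[of al k] assms(2) by simp

lemma depth_eq_uminus:
  assumes "is_partition al" "k \<le> - int (length al)"
  shows "depth al k = - k"
proof -
  have "\<not> - k + 1 \<le> depth al k"
    using le_depth_iff[OF assms(1), of "- k + 1" k] assms(2) by (simp add: part_def)
  moreover have "- k \<le> depth al k"
    using le_depth_iff[OF assms(1), of "- k" k] part_nonneg[of al "- k"] depth_nonneg[of al k]
    by (cases "- k \<ge> 1") auto
  ultimately show ?thesis by simp
qed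

lemma boundary_step_eq:
  assumes "is_partition al"
  shows "boundary_step al k =
    (if depth al (k + 1) < depth al k then VStep (k + depth al k) (- depth al k)
     else HStep (k + depth al k) (- depth al k))" (is "_ = ?e")
proof -
  \<comment> \<open>The first row with \<open>part al n - n \<le> k\<close>, as
    \<open>boundary_path_altdef\<close> demands; equality there means a vertical step.\<close>
  define n where "n = depth al (k + 1) + 1"
  have n: "n \<ge> 1" using depth_nonneg[of al "k + 1"] by (simp add: n_def)
  have "\<not> k + 1 \<le> part al n - n"
    using le_depth_iff[OF assms n, of "k + 1"] by (simp add: n_def)
  moreover have "n = 1 \<or> k < part al (n - 1) - (n - 1)"
    using le_depth_iff[OF assms, of "n - 1" "k + 1"] n unfolding n_def by linarith
  moreover have "part al n - n = k \<longleftrightarrow> depth al (k + 1) < depth al k"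
    using le_depth_iff[OF assms n, of k] calculation by (auto simp: n_def)
  moreover have "?e = (if part al n - n = k then VStep (part al n) (- n)
      else HStep (k + (n - 1)) (1 - n))"
    using depth_step[OF assms, of k] calculation(3) by (auto simp: n_def)
  ultimately have "?e \<in> boundary_path al \<and> step_index ?e = k"
    using n unfolding boundary_path_altdef[OF assms] by (intro exI[of _ n]) auto
  then show ?thesis
    unfolding boundary_step_def using boundary_path_ex1[OF assms, of k] by (intro the1_equality)
qed

text \<open>Each path has one step per index, so membership is equality with step \<open>k\<close>
  of the other path, and a step is determined by its two endpoints.\<close>

lemma boundary_step_in_boundary_path_iff:
  assumes "is_partition al" "is_partition be"
  shows "boundary_step al k \<in> boundary_path be \<longleftrightarrow>
    depth al k = depth be k \<and> depth al (k + 1) = depth be (k + 1)"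
proof -
  have be: "boundary_step be k \<in> boundary_path be \<and> step_index (boundary_step be k) = k"
    unfolding boundary_step_def by (rule theI', rule boundary_path_ex1[OF assms(2)])
  have "step_index (boundary_step al k) = k"
    by (simp add: boundary_step_eq[OF assms(1)])
  then have "boundary_step al k \<in> boundary_path be \<longleftrightarrow> boundary_step al k = boundary_step be k"
    using be boundary_path_ex1[OF assms(2), of k] by metis
  then show ?thesis
    using depth_step[OF assms(1), of k] depth_step[OF assms(2), of k]
    by (auto simp: boundary_step_eq[OF assms(1)] boundary_step_eq[OF assms(2)])
qed

section \<open>Snakes, corners and the rank\<close>

locale skew_shape =
  fixes lam mu :: "nat list"
  assumes lam: "is_partition lam" and mu: "is_partition mu" and mu_le_lam: "part_le mu lam"
begin

definition height :: "int \<Rightarrow> int" where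
  "height k = depth lam k - depth mu k"

text \<open>The squares of content \<open>k\<close>, listed by their interval of rows so that
  \<open>height k\<close> is visibly their number.\<close>

definition content_line :: "int \<Rightarrow> square set" where
  "content_line k = (\<lambda>i. (i, i + k)) ` {depth mu k<..depth lam k}"

lemma height_nonneg: "height k \<ge> 0"
proof (cases "depth mu k \<ge> 1")
  case True
  then have "k \<le> part mu (depth mu k) - depth mu k"
    using le_depth_iff[OF mu, of "depth mu k" k] by simp
  then show ?thesis
    using True mu_le_lam le_depth_iff[OF lam, of "depth mu k" k] by (fastforce simp: part_le_def height_def)
qed (use depth_nonneg[of lam k] in \<open>simp add: height_def\<close>)

lemma mem_skew_iff: "(i, j) \<in> skew lam mu \<longleftrightarrow> depth mu (j - i) < i \<and> i \<le> depth lam (j - i)"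
proof (cases "i \<ge> 1")
  case True
  then show ?thesis
    using le_depth_iff[OF mu True, of "j - i"] le_depth_iff[OF lam True, of "j - i"]
    by (auto simp: skew_def)
qed (use depth_nonneg[of mu "j - i"] in \<open>auto simp: skew_def\<close>)

lemma mem_content_line_iff: "(i, j) \<in> content_line k \<longleftrightarrow> (i, j) \<in> skew lam mu \<and> j = i + k"
  by (auto simp: content_line_def mem_skew_iff)

lemma finite_content_line: "finite (content_line k)"
  by (simp add: content_line_def)

lemma card_content_line: "int (card (content_line k)) = height k"
  using height_nonneg[of k] by (simp add: content_line_def height_def card_image inj_on_def)

definition bound :: int where
  "bound = int (length lam) + int (length mu) + part lam 1 + part mu 1"

lemma bound_nonneg: "bound \<ge> 0"
  using part_nonneg[of lam 1] part_nonneg[of mu 1] by (simp add: bound_def)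

sublocale bump_path height bound
proof
  fix k
  show "height k \<ge> 0" by (rule height_nonneg)
  show "\<bar>height (k + 1) - height k\<bar> \<le> 1"
    using depth_step[OF lam, of k] depth_step[OF mu, of k] by (simp add: height_def)
  show "height k = 0" if "k \<le> - bound \<or> bound \<le> k"
    using that
  proof
    assume "k \<le> - bound"
    then show ?thesis
      using depth_eq_uminus[OF lam, of k] depth_eq_uminus[OF mu, of k]
        part_nonneg[of lam 1] part_nonneg[of mu 1] by (simp add: height_def bound_def)
  next
    assume "bound \<le> k"
    then show ?thesis
      using depth_eq_0[OF lam, of k] depth_eq_0[OF mu, of k]
        part_nonneg[of lam 1] part_nonneg[of mu 1] by (simp add: height_def bound_def)
  qed
qed

text \<open>The two diagonals of the staircase have contents \<open>k\<close> and
  \<open>k + 1\<close> and end at rows \<open>depth lam k\<close> and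
  \<open>depth lam (k + 1)\<close>, the last ones inside \<open>lam\<close>, so neither line is cut
  short.\<close>

lemma skew_Int_staircase:
  "skew lam mu \<inter> staircase (boundary_step lam k) = content_line k \<union> content_line (k + 1)"
proof -
  have mem: "(i, j) \<in> skew lam mu \<Longrightarrow> i \<le> depth lam (j - i)" for i j
    by (simp add: mem_skew_iff)
  have line: "(i, j) \<in> {(a - p, b - p) | p. p \<ge> 0} \<longleftrightarrow> i \<le> a \<and> j = i + (b - a)" for i j a b :: int
    by (auto intro: exI[of _ "a - i"])
  have "(i, j) \<in> skew lam mu \<inter> staircase (boundary_step lam k) \<longleftrightarrow>
      (i, j) \<in> content_line k \<union> content_line (k + 1)" for i j
  proof (cases "depth lam (k + 1) < depth lam k")
    case True
    then have "depth lam (k + 1) = depth lam k - 1" using depth_step[OF lam, of k] by simp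
    with True show ?thesis
      by (auto simp: boundary_step_eq[OF lam] Let_def line mem_content_line_iff dest: mem
        simp del: mem_Collect_eq)
  next
    case False
    then have "depth lam (k + 1) = depth lam k" using depth_step[OF lam, of k] by simp
    with False show ?thesis
      by (auto simp: boundary_step_eq[OF lam] Let_def line mem_content_line_iff dest: mem
        simp del: mem_Collect_eq)
  qed
  then show ?thesis by auto
qed

text \<open>If the step is shared with \<open>mu\<close>, the depths agree at \<open>k\<close> and
  \<open>k + 1\<close>, so both lines are empty and the formula covers this case too.\<close>

lemma snake_eq: "snake lam mu k = content_line k \<union> content_line (k + 1)"
  by (auto simp: snake_def Let_def skew_Int_staircase content_line_def
    boundary_step_in_boundary_path_iff[OF lam mu])

lemma snake_length_eq: "snake_length (snake lam mu k) = height k + height (k + 1) - 1"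
proof -
  have "content_line k \<inter> content_line (k + 1) = {}"
    by (auto simp: content_line_def)
  then show ?thesis
    by (simp add: snake_length_def snake_eq card_Un_disjoint finite_content_line card_content_line)
qed

lemma horizontal_iff: "horizontal (boundary_step lam k) \<longleftrightarrow> depth lam (k + 1) = depth lam k"
  using depth_step[OF lam, of k] by (auto simp: boundary_step_eq[OF lam])

text \<open>On a horizontal step of \<open>lam\<close> only \<open>depth mu\<close> can drop; on a
  vertical one \<open>depth lam\<close> drops and \<open>depth mu\<close> may follow. Hence the
  direction decides the sign of a change.\<close>

lemma height_step:
  "depth lam (k + 1) = depth lam k \<and> (height (k + 1) = height k \<or> height (k + 1) = height k + 1) \<or>
   depth lam (k + 1) \<noteq> depth lam k \<and> (height (k + 1) = height k \<or> height (k + 1) = height k - 1)"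
  using depth_step[OF lam, of k] depth_step[OF mu, of k] unfolding height_def by linarith

text \<open>The length \<open>height k + height (k + 1) - 1\<close> is even exactly when the heights
  differ, and on a horizontal step they can only differ upwards.\<close>

lemma left_snake_iff: "left_snake lam mu k \<longleftrightarrow> k \<in> ups"
  using height_step[of k] height_nonneg[of k]
  by (auto simp: left_snake_def ups_def snake_length_eq horizontal_iff)

lemma right_snake_iff: "right_snake lam mu k \<longleftrightarrow> k \<in> downs"
  using height_step[of k] height_nonneg[of "k + 1"]
  by (auto simp: right_snake_def downs_def snake_length_eq horizontal_iff)

lemma snake_sequence_iff:
  "(\<exists>s. snake_sequence lam mu k = SymL s) \<longleftrightarrow> k \<in> ups"
  "(\<exists>t. snake_sequence lam mu k = SymR t) \<longleftrightarrow> k \<in> downs"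
  using disjoint_steps by (auto simp: snake_sequence_def left_snake_iff right_snake_iff)

text \<open>The boundary path of \<open>mu\<close> goes up from \<open>k\<close> to \<open>k + 1\<close> iff \<open>rise k = 1\<close>, and goes right iff
  \<open>rise k = 0\<close>.\<close>

definition rise :: "int \<Rightarrow> int" where
  "rise k = depth mu k - depth mu (k + 1)"

text \<open>The corner is the first square of its content line, where the path of \<open>mu\<close>
  turns from up to right. The neighbours cannot be missing because of \<open>lam\<close>, whose
  depth moves by at most one.\<close>

lemma outside_top_corner_iff:
  "outside_top_corner lam mu (i, j) \<longleftrightarrow>
    i = depth mu (j - i) + 1 \<and> height (j - i) > 0 \<and> rise (j - i - 1) = 1 \<and> rise (j - i) = 0"
proof -
  define k where "k = j - i"
  have [simp]: "j - i = k" "j - (i - 1) = k + 1" "j - 1 - i = k - 1" by (simp_all add: k_def)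
  show ?thesis
    using depth_step[OF lam, of k] depth_step[OF lam, of "k - 1"]
      depth_step[OF mu, of k] depth_step[OF mu, of "k - 1"]
    unfolding outside_top_corner_def rise_def height_def by (simp add: mem_skew_iff) linarith
qed

lemma inside_top_corner_iff:
  "inside_top_corner lam mu (i, j) \<longleftrightarrow>
    i = depth mu (j - i) + 1 \<and> height (j - i) > 0 \<and> rise (j - i - 1) = 0 \<and> rise (j - i) = 1"
proof -
  define k where "k = j - i"
  have [simp]: "j - i = k" "j - (i - 1) = k + 1" "j - 1 - i = k - 1" "j - 1 - (i - 1) = k"
    by (simp_all add: k_def)
  show ?thesis
    using depth_step[OF lam, of k] depth_step[OF lam, of "k - 1"]
      depth_step[OF mu, of k] depth_step[OF mu, of "k - 1"]
    unfolding inside_top_corner_def rise_def height_def by (simp add: mem_skew_iff) linarith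
qed

lemma diagonal_top:
  assumes "i = depth mu k + 1"
  shows "diagonal lam mu (i, i + k) = content_line k"
proof -
  have line: "(a, b) \<in> {(i + p, i + k + p) |p. p \<ge> 0} \<longleftrightarrow> i \<le> a \<and> b = a + k" for a b
    by (auto intro: exI[of _ "a - i"])
  have "(a, b) \<in> diagonal lam mu (i, i + k) \<longleftrightarrow> (a, b) \<in> content_line k" for a b
    unfolding diagonal_def prod.case Int_iff line mem_content_line_iff mem_skew_iff
    using assms by auto
  then show ?thesis by auto
qed

text \<open>Handles both kinds of corner, \<open>Q\<close> being the turn condition: each corner
  heads a whole content line, distinct lines are disjoint, and lines of height 0 add
  nothing.\<close>

lemma card_corner_diagonals:
  assumes corner: "\<And>i j. corner (i, j) \<longleftrightarrow> i = depth mu (j - i) + 1 \<and> height (j - i) > 0 \<and> Q (j - i)"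
  shows "int (card (\<Union>c\<in>{c. corner c}. diagonal lam mu c)) =
    (\<Sum>k\<in>{- bound..<bound}. of_bool (Q k) * height k)"
proof -
  define A where "A = {k \<in> {- bound..<bound}. Q k \<and> height k > 0}"
  have fin: "finite A"
    by (rule finite_subset[of _ "{- bound..<bound}"]) (auto simp: A_def)
  have "{c. corner c} = (\<lambda>k. (depth mu k + 1, depth mu k + 1 + k)) ` A"
  proof (intro equalityI subsetI)
    fix c assume "c \<in> {c. corner c}"
    then obtain i j where c: "c = (i, j)" "i = depth mu (j - i) + 1" "height (j - i) > 0" "Q (j - i)"
      using corner by (metis mem_Collect_eq surj_pair)
    then have "j - i \<in> A"
      using support[of "j - i"] by (force simp: A_def)
    moreover have "c = (depth mu (j - i) + 1, depth mu (j - i) + 1 + (j - i))"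
      using c(1,2) by simp
    ultimately show "c \<in> (\<lambda>k. (depth mu k + 1, depth mu k + 1 + k)) ` A" by blast
  qed (auto simp: corner A_def)
  then have "(\<Union>c\<in>{c. corner c}. diagonal lam mu c) = (\<Union>k\<in>A. content_line k)"
    by (simp add: diagonal_top)
  also have "int (card \<dots>) = (\<Sum>k\<in>A. height k)"
  proof -
    have "card (\<Union>k\<in>A. content_line k) = (\<Sum>k\<in>A. card (content_line k))"
      using fin by (intro card_UN_disjoint) (auto simp: content_line_def)
    then show ?thesis by (simp add: card_content_line)
  qed
  also have "\<dots> = (\<Sum>k\<in>{- bound..<bound}. of_bool (Q k) * height k)"
    using height_nonneg by (intro sum.mono_neutral_cong_left) (auto simp: A_def order_le_less)
  finally show ?thesis .
qed

text \<open>Both corner sums together have the coefficient \<open>rise (k - 1) - rise k\<close> at \<open>height k\<close>; summation by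
  parts moves the difference to \<open>height\<close>.\<close>

lemma skew_rank_eq: "skew_rank lam mu = int (card ups)"
proof -
  have rise: "rise k = 0 \<or> rise k = 1" for k
    using depth_step[OF mu, of k] by (auto simp: rise_def)
  \<comment> \<open>If \<open>mu\<close> goes up, the height grows by one when \<open>lam\<close>
    goes right and stays when \<open>lam\<close> goes up; if \<open>mu\<close> goes right, the
    height cannot grow.\<close>
  have up: "rise k * (height (k + 1) - height k) = of_bool (k \<in> ups)" for k
    using depth_step[OF lam, of k] rise[of k] by (auto simp: rise_def ups_def height_def)
  \<comment> \<open>The boundary term of the summation by parts; it vanishes at both ends of the
    window.\<close>
  define g where "g k = rise (k - 1) * height k" for k
  have "skew_rank lam mu = (\<Sum>k\<in>{- bound..<bound}.
      of_bool (rise (k - 1) = 1 \<and> rise k = 0) * height k -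
      of_bool (rise (k - 1) = 0 \<and> rise k = 1) * height k)"
    unfolding skew_rank_def sum_subtractf
    by (intro arg_cong2[where f = "(-)"] card_corner_diagonals outside_top_corner_iff
      inside_top_corner_iff)
  also have "\<dots> = (\<Sum>k\<in>{- bound..<bound}. of_bool (k \<in> ups) - (g (k + 1) - g k))"
  proof (rule sum.cong[OF refl])
    fix k
    have "of_bool (rise (k - 1) = 1 \<and> rise k = 0) * height k -
        of_bool (rise (k - 1) = 0 \<and> rise k = 1) * height k = (rise (k - 1) - rise k) * height k"
      using rise[of k] rise[of "k - 1"] by auto
    also have "\<dots> = rise k * (height (k + 1) - height k) - (g (k + 1) - g k)"
      by (simp add: g_def algebra_simps)
    finally show "of_bool (rise (k - 1) = 1 \<and> rise k = 0) * height k -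
        of_bool (rise (k - 1) = 0 \<and> rise k = 1) * height k = of_bool (k \<in> ups) - (g (k + 1) - g k)"
      by (simp only: up)
  qed
  also have "\<dots> = (\<Sum>k\<in>{- bound..<bound}. of_bool (k \<in> ups)) - (g bound - g (- bound))"
    unfolding sum_subtractf[of _ "\<lambda>k. g (k + 1) - g k"]
    by (subst sum_int_telescope) (simp_all add: bound_nonneg)
  also have "(\<Sum>k\<in>{- bound..<bound}. of_bool (k \<in> ups)) = int (card ups)"
    using steps_bounded(1) by (simp add: Int_absorb1)
  also have "g bound - g (- bound) = 0"
    using support[of bound] support[of "- bound"] by (simp add: g_def)
  finally show ?thesis by simp
qed

section \<open>The two product formulas\<close>

lemma num_interval_sets_eq: "num_interval_sets lam mu = card step_matchings"
proof -
  have "{I. interval_set lam mu I} = step_matchings"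
    by (simp only: interval_set_def step_matchings_def snake_sequence_iff skew_rank_eq of_nat_eq_iff)
  then show ?thesis by (simp add: num_interval_sets_def)
qed

text \<open>The snake at an up-step has length \<open>2 * height k\<close>; at a down-step it has
  \<open>2 * height k - 2\<close>.\<close>

lemma left_snake_factor:
  "k \<in> ups \<Longrightarrow> 1 + real_of_int (snake_length (snake lam mu k)) / 2 = real_of_int (height k + 1)"
  by (simp add: snake_length_eq ups_def)

lemma right_snake_factor:
  "k \<in> downs \<Longrightarrow> 1 + real_of_int (snake_length (snake lam mu k)) / 2 = real_of_int (height k)"
  by (simp add: snake_length_eq downs_def field_simps)

lemma real_num_interval_sets:
  "real (num_interval_sets lam mu) =
    (\<Prod>k\<in>ups. 1 + real_of_int (snake_length (snake lam mu k)) / 2)"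
  "real (num_interval_sets lam mu) =
    (\<Prod>k\<in>downs. 1 + real_of_int (snake_length (snake lam mu k)) / 2)"
proof -
  have "real (num_interval_sets lam mu) = real_of_int (int (card step_matchings))"
    by (simp add: num_interval_sets_eq)
  then have "real (num_interval_sets lam mu) = (\<Prod>k\<in>ups. real_of_int (height k + 1))"
    "real (num_interval_sets lam mu) = (\<Prod>k\<in>downs. real_of_int (height k))"
    by (simp_all only: card_step_matchings_ups flip: of_int_prod)
      (simp only: card_step_matchings_downs flip: card_step_matchings_ups)
  then show
    "real (num_interval_sets lam mu) =
      (\<Prod>k\<in>ups. 1 + real_of_int (snake_length (snake lam mu k)) / 2)"
    "real (num_interval_sets lam mu) =
      (\<Prod>k\<in>downs. 1 + real_of_int (snake_length (snake lam mu k)) / 2)"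
    by (simp_all only: left_snake_factor right_snake_factor cong: prod.cong)
qed

end

theorem theorem4p4:
  fixes lam mu :: "nat list"
  assumes "is_partition lam" and "is_partition mu" and "part_le mu lam"
  shows
    "finite {k. left_snake lam mu k} \<and>
     int (card {k. left_snake lam mu k}) = skew_rank lam mu \<and>
     real (num_interval_sets lam mu) =
       (\<Prod>k \<in> {k. left_snake lam mu k}. 1 + real_of_int (snake_length (snake lam mu k)) / 2) \<and>
     finite {k. right_snake lam mu k} \<and>
     int (card {k. right_snake lam mu k}) = skew_rank lam mu \<and>
     real (num_interval_sets lam mu) =
       (\<Prod>k \<in> {k. right_snake lam mu k}. 1 + real_of_int (snake_length (snake lam mu k)) / 2)"
proof -
  interpret skew_shape lam mu by standard (fact assms)+
  have "{k. left_snake lam mu k} = ups" "{k. right_snake lam mu k} = downs"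
    by (simp_all add: left_snake_iff right_snake_iff)
  then show ?thesis
    using finite_steps card_ups_eq_card_downs skew_rank_eq real_num_interval_sets by simp
qed

end
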